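(* Let $\mathbf{U}_{i,j}(t)$, $0\le i<N_x$, $0\le j<N_y$, be a differentiable-in-time solution, with admissible values, of the semi-discrete scheme $$\frac{d \mathbf{U}_{i,j}}{d t} +\frac{1}{\Delta x} \left(\mathbf{F}^x_{i+\frac12,j} - \mathbf{F}^x_{i-\frac12,j}\right) + \frac{1}{\Delta y} \left(\mathbf{F}^y_{i,j+\frac12} - \mathbf{F}^y_{i,j-\frac12}\right) = \mathcal{S}(\mathbf{U}_{i,j})$$ for the two-fluid relativistic plasma flow equations, where the Maxwell components of the numerical fluxes are the multidimensional-Riemann-solver fluxes $\mathbf{F}^x_m,\mathbf{F}^y_m$ with the second-order MinMod reconstruction (all as defined in the context). Then the discrete divergence of the magnetic field satisfies $$\frac{d}{d t} \left(\nabla \cdot \mathbf{B}\right)_{i+\frac12,j+\frac12} = 0$$ for every vertex $(x_{i+\frac12},y_{j+\frac12})$ with $0\le i\le N_x-2$, $0\le j\le N_y-2$ (which is consistent with the continuous identity $\partial_t(\nabla\cdot\mathbf{B})=0$).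
   Context: **Unknowns.** Two fluid species $\alpha\in\{i,e\}$ (ions, electrons) with primitive variables: density $\rho_\alpha>0$, pressure $p_\alpha>0$, velocity $\mathbf{u}_\alpha=(u^x_\alpha,u^y_\alpha,u^z_\alpha)$, $|\mathbf{u}_\alpha|<1$. Constants: $\gamma_\alpha\in(1,2]$ and charge-to-mass ratios $r_\alpha\in\mathbb{R}$. Put $\Gamma_\alpha=(1-|\mathbf{u}_\alpha|^2)^{-1/2}$, $h_\alpha=1+\frac{\gamma_\alpha}{\gamma_\alpha-1}\frac{p_\alpha}{\rho_\alpha}$, $D_\alpha=\rho_\alpha\Gamma_\alpha$, $\mathbf{m}_\alpha=(m_\alpha^x,m_\alpha^y,m_\alpha^z)=\rho_\alpha h_\alpha\Gamma_\alpha^2\mathbf{u}_\alpha$, $\mathcal{E}_\alpha=\rho_\alpha h_\alpha\Gamma_\alpha^2-p_\alpha$ (total energy density). The conservative vector is $\mathbf{U}=(\mathbf{U}_i,\mathbf{U}_e,\mathbf{U}_m)\in\mathbb{R}^{16}$, $\mathbf{U}_\alpha=(D_\alpha,\mathbf{m}_\alpha,\mathcal{E}_\alpha)$, $\mathbf{U}_m=(\mathbf{B},\mathbf{E})=(B_x,B_y,B_z,E_x,E_y,E_z)$. A state is admissible if its fluid parts come from primitive variables satisfying the inequalities above. The current density is $\mathbf{J}=(J_x,J_y,J_z)=\sum_{\alpha}r_\alpha\rho_\alpha\Gamma_\alpha\mathbf{u}_\alpha$. **Source.** $\mathcal{S}=(\mathcal{S}_i,\mathcal{S}_e,\mathcal{S}_m)$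 with $\mathcal{S}_\alpha=\big(0,\ r_\alpha D_\alpha(\mathbf{E}+\mathbf{u}_\alpha\times\mathbf{B}),\ r_\alpha D_\alpha\,\mathbf{u}_\alpha\cdot\mathbf{E}\big)$ and $\mathcal{S}_m=(0,0,0,-J_x,-J_y,-J_z)$. **Mesh.** Uniform rectangular mesh of $[a,b]\times[c,d]$ with cells of size $\Delta x\times\Delta y$, centers $x_i=a+(i+\frac12)\Delta x$, $y_j=c+(j+\frac12)\Delta y$, $0\le i<N_x$, $0\le j<N_y$; vertices $(x_{i+\frac12},y_{j+\frac12})$, $x_{i+\frac12}=\frac{x_i+x_{i+1}}2$, $y_{j+\frac12}=\frac{y_j+y_{j+1}}2$. (The species label $i$ and the cell index $i$ are unrelated.) The scheme is imposed in every cell of the grid; values in cells outside the grid (ghost cells) needed by the stencils are prescribed by the boundary conditions and may be arbitrary. **Fluxes.** $\mathbf{F}^d=(\mathbf{F}^d_i,\mathbf{F}^d_e,\mathbf{F}^d_m)$, $d\in\{x,y\}$. The fluid fluxes $\mathbf{F}^d_\alpha$ are any numerical fluxes consistent with $\mathbf{f}_\alpha^x=(D_\alpha u_\alpha^x, m_\alpha^xu_\alpha^x+p_\alpha, m_\alpha^yu_\alpha^x,m_\alpha^zu_\alpha^x,m_\alpha^x)$ and $\mathbf{f}_\alpha^y=(D_\alpha u_\alpha^y, m_\alpha^xu_\alpha^y, m_\alpha^yu_\alpha^y+p_\alpha,m_\alpha^zu_\alpha^y,m_\alpha^y)$. The Maxwell fluxes are $$\mathbf{F}_{m,i+\frac12,j}^x=\Big(0,\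 -\tfrac12(\tilde E_{z,i+\frac12,j+\frac12}+\tilde E_{z,i+\frac12,j-\frac12}),\ \tilde F^{x,3}_{m,i+\frac12,j},\ 0,\ \tfrac12(\tilde B_{z,i+\frac12,j+\frac12}+\tilde B_{z,i+\frac12,j-\frac12}),\ \tilde F^{x,6}_{m,i+\frac12,j}\Big),$$ $$\mathbf{F}_{m,i,j+\frac12}^y=\Big(\tfrac12(\tilde E_{z,i+\frac12,j+\frac12}+\tilde E_{z,i-\frac12,j+\frac12}),\ 0,\ \tilde F^{y,3}_{m,i,j+\frac12},\ -\tfrac12(\tilde B_{z,i+\frac12,j+\frac12}+\tilde B_{z,i-\frac12,j+\frac12}),\ 0,\ \tilde F^{y,6}_{m,i,j+\frac12}\Big).$$ **MinMod** (componentwise): $\mathrm{MinMod}(a,b,c)=\mathrm{sign}(b-a)\min\{|c-b|,|b-a|\}$ if $\mathrm{sign}(b-a)=\mathrm{sign}(c-b)$, and $0$ otherwise. **Vertex values.** At vertex $(i+\frac12,j+\frac12)$, dropping the subscript $m$ on $\mathbf{U}_m$, the diagonal reconstructions are $\hat{\mathbf{U}}^{SW}=\mathbf{U}_{i,j}+\frac12\mathrm{MinMod}(\mathbf{U}_{i-1,j-1},\mathbf{U}_{i,j},\mathbf{U}_{i+1,j+1})$, $\hat{\mathbf{U}}^{SE}=\mathbf{U}_{i+1,j}+\frac12\mathrm{MinMod}(\mathbf{U}_{i+2,j-1},\mathbf{U}_{i+1,j},\mathbf{U}_{i,j+1})$, $\hat{\mathbf{U}}^{NE}=\mathbf{U}_{i+1,j+1}+\frac12\mathrm{MinMod}(\mathbf{U}_{i+2,j+2},\mathbf{U}_{i+1,j+1},\mathbf{U}_{i,j})$,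 $\hat{\mathbf{U}}^{NW}=\mathbf{U}_{i,j+1}+\frac12\mathrm{MinMod}(\mathbf{U}_{i-1,j+2},\mathbf{U}_{i,j+1},\mathbf{U}_{i+1,j})$, and, with all hatted quantities taken at $(i+\frac12,j+\frac12)$, $$\tilde E_{z,i+\frac12,j+\frac12}=\tfrac14(\hat E_z^{SW}+\hat E_z^{SE}+\hat E_z^{NE}+\hat E_z^{NW})+\tfrac14(\hat B_y^{SE}+\hat B_y^{NE}-\hat B_y^{SW}-\hat B_y^{NW})-\tfrac14(\hat B_x^{NW}+\hat B_x^{NE}-\hat B_x^{SW}-\hat B_x^{SE}),$$ $$\tilde B_{z,i+\frac12,j+\frac12}=\tfrac14(\hat B_z^{SW}+\hat B_z^{SE}+\hat B_z^{NE}+\hat B_z^{NW})-\tfrac14(\hat E_x^{NW}+\hat E_x^{NE}-\hat E_x^{SW}-\hat E_x^{SE})+\tfrac14(\hat E_y^{SE}+\hat E_y^{NE}-\hat E_y^{SW}-\hat E_y^{NW}).$$ **One-dimensional components.** With $\mathbf{U}^-_{i+\frac12,j}=\mathbf{U}_{i,j}+\frac12\mathrm{MinMod}(\mathbf{U}_{i-1,j},\mathbf{U}_{i,j},\mathbf{U}_{i+1,j})$ and $\mathbf{U}^+_{i+\frac12,j}=\mathbf{U}_{i+1,j}-\frac12\mathrm{MinMod}(\mathbf{U}_{i,j},\mathbf{U}_{i+1,j},\mathbf{U}_{i+2,j})$ (for $\mathbf{U}_m$), set $\tilde F^{x,3}_m=\frac12(E_y^-+E_y^+)-\frac12(B_z^+-B_z^-)$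 and $\tilde F^{x,6}_m=-\frac12(B_y^-+B_y^+)-\frac12(E_z^+-E_z^-)$ at $(i+\frac12,j)$; analogously, with traces $\mathbf{U}^\pm_{i,j+\frac12}$ reconstructed in the $y$-direction, $\tilde F^{y,3}_m=-\frac12(E_x^-+E_x^+)-\frac12(B_z^+-B_z^-)$ and $\tilde F^{y,6}_m=\frac12(B_x^-+B_x^+)-\frac12(E_z^+-E_z^-)$ at $(i,j+\frac12)$. **Discrete divergence** of a grid vector function $\mathbf{A}=(A_x,A_y,A_z)$ at a vertex: $$(\nabla\cdot\mathbf{A})_{i+\frac12,j+\frac12}=\frac12\left(\frac{A_{x,i+1,j+1}-A_{x,i,j+1}}{\Delta x}+\frac{A_{x,i+1,j}-A_{x,i,j}}{\Delta x}\right)+\frac12\left(\frac{A_{y,i+1,j+1}-A_{y,i+1,j}}{\Delta y}+\frac{A_{y,i,j+1}-A_{y,i,j}}{\Delta y}\right).$$ *)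

theory Defs
  imports "HOL-Analysis.Analysis"
begin

section \<open>States of the two-fluid relativistic plasma flow equations\<close>

datatype species = Ion | Electron

record primitive =
  rho :: real
  pres :: real
  vel :: "real^3"

text \<open>Conservative variables: a fluid vector is \<open>(D, m, energy)\<close>, a Maxwell vector is
  \<open>(B, E)\<close>, and a full state \<open>(U\<^sub>i, U\<^sub>e, U\<^sub>m)\<close> has \<open>5 + 5 + 6 = 16\<close> real components.\<close>

type_synonym fluid = "real \<times> (real^3) \<times> real"
type_synonym maxwell = "(real^3) \<times> (real^3)"
type_synonym state = "fluid \<times> fluid \<times> maxwell"

abbreviation maxwell_part :: "state \<Rightarrow> maxwell"
  where "maxwell_part U \<equiv> snd (snd U)"

abbreviation magnetic :: "maxwell \<Rightarrow> real^3"
  where "magnetic M \<equiv> fst M"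

abbreviation electric :: "maxwell \<Rightarrow> real^3"
  where "electric M \<equiv> snd M"

definition physical :: "primitive \<Rightarrow> bool"
  where "physical w \<longleftrightarrow> rho w > 0 \<and> pres w > 0 \<and> norm (vel w) < 1"

definition lorentz :: "primitive \<Rightarrow> real"
  where "lorentz w = 1 / sqrt (1 - (norm (vel w))\<^sup>2)"

definition enthalpy :: "real \<Rightarrow> primitive \<Rightarrow> real"
  where "enthalpy \<gamma> w = 1 + \<gamma> / (\<gamma> - 1) * (pres w / rho w)"

definition dens :: "primitive \<Rightarrow> real"
  where "dens w = rho w * lorentz w"

definition momentum :: "real \<Rightarrow> primitive \<Rightarrow> real^3"
  where "momentum \<gamma> w = (rho w * enthalpy \<gamma> w * (lorentz w)\<^sup>2) *\<^sub>R vel w"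

definition energy :: "real \<Rightarrow> primitive \<Rightarrow> real"
  where "energy \<gamma> w = rho w * enthalpy \<gamma> w * (lorentz w)\<^sup>2 - pres w"

definition conserved_fluid :: "real \<Rightarrow> primitive \<Rightarrow> fluid"
  where "conserved_fluid \<gamma> w = (dens w, momentum \<gamma> w, energy \<gamma> w)"

definition conserved :: "(species \<Rightarrow> real) \<Rightarrow> (species \<Rightarrow> primitive) \<Rightarrow> maxwell \<Rightarrow> state"
  where "conserved \<gamma> w M =
    (conserved_fluid (\<gamma> Ion) (w Ion), conserved_fluid (\<gamma> Electron) (w Electron), M)"

text \<open>\<open>w\<close> witnesses that \<open>U\<close> is an admissible state.\<close>

definition admissible_via :: "(species \<Rightarrow> real) \<Rightarrow> (species \<Rightarrow> primitive) \<Rightarrow> state \<Rightarrow> bool"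
  where "admissible_via \<gamma> w U \<longleftrightarrow>
    (\<forall>\<alpha>. physical (w \<alpha>)) \<and> U = conserved \<gamma> w (maxwell_part U)"


section \<open>Source\<close>

definition fluid_source :: "real \<Rightarrow> primitive \<Rightarrow> maxwell \<Rightarrow> fluid"
  where "fluid_source r w M =
    (0,
     (r * dens w) *\<^sub>R (electric M + cross3 (vel w) (magnetic M)),
     r * dens w * inner (vel w) (electric M))"

definition current :: "(species \<Rightarrow> real) \<Rightarrow> (species \<Rightarrow> primitive) \<Rightarrow> real^3"
  where "current r w = (\<Sum>\<alpha>\<in>{Ion, Electron}. (r \<alpha> * rho (w \<alpha>) * lorentz (w \<alpha>)) *\<^sub>R vel (w \<alpha>))"

text \<open>The source depends on the velocities, hence is written as a function of the primitive
  variables of the fluids and of the Maxwell part.\<close>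

definition source ::
    "(species \<Rightarrow> real) \<Rightarrow> (species \<Rightarrow> primitive) \<Rightarrow> maxwell \<Rightarrow> state"
  where "source r w M =
    (fluid_source (r Ion) (w Ion) M, fluid_source (r Electron) (w Electron) M,
     (0, - current r w))"


section \<open>Fluid fluxes\<close>

text \<open>Physical flux in the coordinate direction \<open>k\<close> (\<open>1\<close> for \<open>x\<close>, \<open>2\<close> for \<open>y\<close>). The vector
  \<open>axis k p\<close> adds the pressure to the \<open>k\<close>-th momentum flux.\<close>

definition fluid_flux :: "3 \<Rightarrow> real \<Rightarrow> primitive \<Rightarrow> fluid"
  where "fluid_flux k \<gamma> w =
    (dens w * vel w $ k,
     (vel w $ k) *\<^sub>R momentum \<gamma> w + axis k (pres w),
     momentum \<gamma> w $ k)"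

text \<open>Grid functions are indexed by all integer cells, so that they include ghost cells. Half
  integers are rounded down: a quantity at \<open>(i + 1/2, j)\<close>, \<open>(i, j + 1/2)\<close> or
  \<open>(i + 1/2, j + 1/2)\<close> is indexed by \<open>i j\<close>.\<close>

type_synonym 'a grid = "int \<Rightarrow> int \<Rightarrow> 'a"

text \<open>A numerical flux maps a grid function of states (any stencil) to its values at the faces.
  It is consistent if it returns the physical flux on each constant admissible state.\<close>

type_synonym numerical_flux = "state grid \<Rightarrow> fluid grid"

definition consistent_flux ::
    "(species \<Rightarrow> real) \<Rightarrow> species \<Rightarrow> 3 \<Rightarrow> numerical_flux \<Rightarrow> bool"
  where "consistent_flux \<gamma> \<alpha> k F \<longleftrightarrow>
    (\<forall>w M. (\<forall>\<beta>. physical (w \<beta>)) \<longrightarrow>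
       (\<forall>i j. F (\<lambda>_ _. conserved \<gamma> w M) i j = fluid_flux k (\<gamma> \<alpha>) (w \<alpha>)))"


section \<open>Maxwell fluxes\<close>

definition minmod :: "real \<Rightarrow> real \<Rightarrow> real \<Rightarrow> real"
  where "minmod a b c =
    (if sgn (b - a) = sgn (c - b) then sgn (b - a) * min \<bar>c - b\<bar> \<bar>b - a\<bar> else 0)"

definition minmod_vec :: "real^3 \<Rightarrow> real^3 \<Rightarrow> real^3 \<Rightarrow> real^3"
  where "minmod_vec a b c = (\<chi> k. minmod (a $ k) (b $ k) (c $ k))"

definition MinMod :: "maxwell \<Rightarrow> maxwell \<Rightarrow> maxwell \<Rightarrow> maxwell"
  where "MinMod a b c =
    (minmod_vec (fst a) (fst b) (fst c), minmod_vec (snd a) (snd b) (snd c))"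

abbreviation (input) "B_x M \<equiv> magnetic M $ 1"
abbreviation (input) "B_y M \<equiv> magnetic M $ 2"
abbreviation (input) "B_z M \<equiv> magnetic M $ 3"
abbreviation (input) "E_x M \<equiv> electric M $ 1"
abbreviation (input) "E_y M \<equiv> electric M $ 2"
abbreviation (input) "E_z M \<equiv> electric M $ 3"

subsection \<open>Vertex values\<close>

definition recSW :: "maxwell grid \<Rightarrow> maxwell grid"
  where "recSW V i j = V i j
    + (1/2) *\<^sub>R MinMod (V (i-1) (j-1)) (V i j) (V (i+1) (j+1))"

definition recSE :: "maxwell grid \<Rightarrow> maxwell grid"
  where "recSE V i j = V (i+1) j
    + (1/2) *\<^sub>R MinMod (V (i+2) (j-1)) (V (i+1) j) (V i (j+1))"

definition recNE :: "maxwell grid \<Rightarrow> maxwell grid"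
  where "recNE V i j = V (i+1) (j+1)
    + (1/2) *\<^sub>R MinMod (V (i+2) (j+2)) (V (i+1) (j+1)) (V i j)"

definition recNW :: "maxwell grid \<Rightarrow> maxwell grid"
  where "recNW V i j = V i (j+1)
    + (1/2) *\<^sub>R MinMod (V (i-1) (j+2)) (V i (j+1)) (V (i+1) j)"

definition vertex_Ez :: "maxwell grid \<Rightarrow> real grid"
  where "vertex_Ez V i j =
    (let SW = recSW V i j; SE = recSE V i j; NE = recNE V i j; NW = recNW V i j in
       1/4 * (E_z SW + E_z SE + E_z NE + E_z NW)
     + 1/4 * (B_y SE + B_y NE - B_y SW - B_y NW)
     - 1/4 * (B_x NW + B_x NE - B_x SW - B_x SE))"

definition vertex_Bz :: "maxwell grid \<Rightarrow> real grid"
  where "vertex_Bz V i j =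
    (let SW = recSW V i j; SE = recSE V i j; NE = recNE V i j; NW = recNW V i j in
       1/4 * (B_z SW + B_z SE + B_z NE + B_z NW)
     - 1/4 * (E_x NW + E_x NE - E_x SW - E_x SE)
     + 1/4 * (E_y SE + E_y NE - E_y SW - E_y NW))"

subsection \<open>One-dimensional components\<close>

definition trace_x_minus :: "maxwell grid \<Rightarrow> maxwell grid"
  where "trace_x_minus V i j = V i j
    + (1/2) *\<^sub>R MinMod (V (i-1) j) (V i j) (V (i+1) j)"

definition trace_x_plus :: "maxwell grid \<Rightarrow> maxwell grid"
  where "trace_x_plus V i j = V (i+1) j
    - (1/2) *\<^sub>R MinMod (V i j) (V (i+1) j) (V (i+2) j)"

definition trace_y_minus :: "maxwell grid \<Rightarrow> maxwell grid"
  where "trace_y_minus V i j = V i j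
    + (1/2) *\<^sub>R MinMod (V i (j-1)) (V i j) (V i (j+1))"

definition trace_y_plus :: "maxwell grid \<Rightarrow> maxwell grid"
  where "trace_y_plus V i j = V i (j+1)
    - (1/2) *\<^sub>R MinMod (V i j) (V i (j+1)) (V i (j+2))"

definition flux_x3 :: "maxwell grid \<Rightarrow> real grid"
  where "flux_x3 V i j =
    (let M = trace_x_minus V i j; P = trace_x_plus V i j in
       1/2 * (E_y M + E_y P) - 1/2 * (B_z P - B_z M))"

definition flux_x6 :: "maxwell grid \<Rightarrow> real grid"
  where "flux_x6 V i j =
    (let M = trace_x_minus V i j; P = trace_x_plus V i j in
       - (1/2) * (B_y M + B_y P) - 1/2 * (E_z P - E_z M))"

definition flux_y3 :: "maxwell grid \<Rightarrow> real grid"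
  where "flux_y3 V i j =
    (let M = trace_y_minus V i j; P = trace_y_plus V i j in
       - (1/2) * (E_x M + E_x P) - 1/2 * (B_z P - B_z M))"

definition flux_y6 :: "maxwell grid \<Rightarrow> real grid"
  where "flux_y6 V i j =
    (let M = trace_y_minus V i j; P = trace_y_plus V i j in
       1/2 * (B_x M + B_x P) - 1/2 * (E_z P - E_z M))"

subsection \<open>Multidimensional-Riemann-solver fluxes\<close>

definition maxwell_flux_x :: "maxwell grid \<Rightarrow> maxwell grid"
  where "maxwell_flux_x V i j =
    (vector [0, - (1/2) * (vertex_Ez V i j + vertex_Ez V i (j-1)), flux_x3 V i j],
     vector [0, 1/2 * (vertex_Bz V i j + vertex_Bz V i (j-1)), flux_x6 V i j])"

definition maxwell_flux_y :: "maxwell grid \<Rightarrow> maxwell grid"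
  where "maxwell_flux_y V i j =
    (vector [1/2 * (vertex_Ez V i j + vertex_Ez V (i-1) j), 0, flux_y3 V i j],
     vector [- (1/2) * (vertex_Bz V i j + vertex_Bz V (i-1) j), 0, flux_y6 V i j])"


section \<open>The semi-discrete scheme\<close>

definition full_flux ::
    "(species \<Rightarrow> numerical_flux) \<Rightarrow> (maxwell grid \<Rightarrow> maxwell grid) \<Rightarrow> state grid \<Rightarrow> state grid"
  where "full_flux F G V i j =
    (F Ion V i j, F Electron V i j, G (\<lambda>k l. maxwell_part (V k l)) i j)"

text \<open>\<open>U\<close> is, on the time set \<open>T\<close>, an admissible solution of the scheme in the cells
  \<open>0 \<le> i < Nx\<close>, \<open>0 \<le> j < Ny\<close>. Nothing is required in the ghost cells. The argument \<open>s\<close> of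
  \<open>U\<close> is time.\<close>

definition scheme_solution ::
    "(species \<Rightarrow> real) \<Rightarrow> (species \<Rightarrow> real) \<Rightarrow> nat \<Rightarrow> nat \<Rightarrow> real \<Rightarrow> real \<Rightarrow>
     (species \<Rightarrow> numerical_flux) \<Rightarrow> (species \<Rightarrow> numerical_flux) \<Rightarrow>
     real set \<Rightarrow> (real \<Rightarrow> state grid) \<Rightarrow> bool"
  where "scheme_solution \<gamma> r Nx Ny \<Delta>x \<Delta>y Fx Fy T U \<longleftrightarrow>
    (\<forall>t\<in>T. \<forall>i\<in>{0..<int Nx}. \<forall>j\<in>{0..<int Ny}.
      \<exists>w dU.
        admissible_via \<gamma> w (U t i j) \<and>
        ((\<lambda>s. U s i j) has_vector_derivative dU) (at t within T) \<and>
        dU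
        + (1/\<Delta>x) *\<^sub>R (full_flux Fx maxwell_flux_x (U t) i j
                    - full_flux Fx maxwell_flux_x (U t) (i-1) j)
        + (1/\<Delta>y) *\<^sub>R (full_flux Fy maxwell_flux_y (U t) i j
                    - full_flux Fy maxwell_flux_y (U t) i (j-1))
        = source r w (maxwell_part (U t i j)))"

definition discrete_div :: "real \<Rightarrow> real \<Rightarrow> (real^3) grid \<Rightarrow> real grid"
  where "discrete_div \<Delta>x \<Delta>y A i j =
      1/2 * ((A (i+1) (j+1) $ 1 - A i (j+1) $ 1) / \<Delta>x + (A (i+1) j $ 1 - A i j $ 1) / \<Delta>x)
    + 1/2 * ((A (i+1) (j+1) $ 2 - A (i+1) j $ 2) / \<Delta>y + (A i (j+1) $ 2 - A i j $ 2) / \<Delta>y)"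

end

theory Submission
  imports Defs
begin

text \<open>
  Only the first two magnetic components enter the discrete divergence. For these, the flux
  \<open>F\<^sup>x\<close> has no \<open>B\<^sub>x\<close>-component, the flux \<open>F\<^sup>y\<close> has no \<open>B\<^sub>y\<close>-component, the source vanishes, and
  the remaining flux components are averages of one and the same vertex field \<open>e = E\<^sub>z\<close>. Let
  \<open>\<delta>\<^sub>x\<close>, \<open>\<mu>\<^sub>x\<close> denote the difference and the average of two neighbours in the \<open>x\<close>-direction, and
  \<open>\<delta>\<^sub>y\<close>, \<open>\<mu>\<^sub>y\<close> those in the \<open>y\<close>-direction. The scheme then reads
  \<open>dB\<^sub>x/dt = - \<delta>\<^sub>y \<mu>\<^sub>x e / \<Delta>y\<close> and \<open>dB\<^sub>y/dt = \<delta>\<^sub>x \<mu>\<^sub>y e / \<Delta>x\<close> in each cell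
  (\<open>magnetic_field_derivative\<close>): a discrete curl taken from vertices to cells. The discrete
  divergence, taken from cells to vertices, is
  \<open>\<delta>\<^sub>x \<mu>\<^sub>y B\<^sub>x / \<Delta>x + \<delta>\<^sub>y \<mu>\<^sub>x B\<^sub>y / \<Delta>y\<close>. The four operators are translation invariant and hence
  commute, so the two second-order terms
  \<open>\<delta>\<^sub>x \<mu>\<^sub>y \<delta>\<^sub>y \<mu>\<^sub>x e / (\<Delta>x \<Delta>y)\<close> cancel (\<open>discrete_div_vertex_curl\<close>). The
  cancellation rests on all faces that meet at a vertex sharing one value of \<open>e\<close> there.
\<close>

text \<open>
  The horizontal part of the curl of the vertex field \<open>(0, 0, e)\<close>, evaluated in cell centres.
  The vertices of cell \<open>(i, j)\<close> carry the indices \<open>i - 1\<close>, \<open>i\<close> and \<open>j - 1\<close>, \<open>j\<close>.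
\<close>

definition curl_x :: "real \<Rightarrow> real grid \<Rightarrow> real grid"
  where "curl_x \<Delta>y e i j = (e i j + e (i-1) j - e i (j-1) - e (i-1) (j-1)) / (2 * \<Delta>y)"

definition curl_y :: "real \<Rightarrow> real grid \<Rightarrow> real grid"
  where "curl_y \<Delta>x e i j = - (e i j + e i (j-1) - e (i-1) j - e (i-1) (j-1)) / (2 * \<Delta>x)"

text \<open>
  The discrete form of \<open>div curl = 0\<close>. Both double differences at the vertex \<open>(i, j)\<close> weight the
  surrounding vertex values of \<open>e\<close> by the same stencil, namely the product of the one-dimensional
  stencils \<open>\<delta>\<^sub>x \<mu>\<^sub>x\<close> and \<open>\<delta>\<^sub>y \<mu>\<^sub>y\<close>, and the minus sign in the curl makes them cancel.
\<close>

lemma discrete_div_vertex_curl: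
  assumes "\<And>k l. k \<in> {i, i+1} \<Longrightarrow> l \<in> {j, j+1} \<Longrightarrow> A k l $ 1 = - curl_x \<Delta>y e k l"
    and "\<And>k l. k \<in> {i, i+1} \<Longrightarrow> l \<in> {j, j+1} \<Longrightarrow> A k l $ 2 = - curl_y \<Delta>x e k l"
  shows "discrete_div \<Delta>x \<Delta>y A i j = 0"
  by (simp add: discrete_div_def assms curl_x_def curl_y_def diff_divide_distrib
      add_divide_distrib mult.commute mult.left_commute)

lemma discrete_div_has_real_derivative:
  assumes "\<And>k l. k \<in> {i, i+1} \<Longrightarrow> l \<in> {j, j+1} \<Longrightarrow>
    ((\<lambda>s. A s k l) has_vector_derivative A' k l) (at t within T)"
  shows "((\<lambda>s. discrete_div \<Delta>x \<Delta>y (A s) i j)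
    has_real_derivative discrete_div \<Delta>x \<Delta>y A' i j) (at t within T)"
proof -
  have comp: "((\<lambda>s. A s k l $ n) has_real_derivative A' k l $ n) (at t within T)"
    if "k \<in> {i, i+1}" "l \<in> {j, j+1}" for k l n
    using bounded_linear.has_vector_derivative[OF bounded_linear_vec_nth assms[OF that]]
    by (simp add: has_real_derivative_iff_has_vector_derivative)
  show ?thesis
    unfolding discrete_div_def by (intro DERIV_add DERIV_cmult DERIV_cdivide DERIV_diff comp) auto
qed

text \<open>
  Faraday's law for the scheme: the horizontal magnetic field evolves by the discrete curl of the
  reconstructed vertex values of \<open>E\<^sub>z\<close>, because the current enters only the electric equations.
\<close>

lemma magnetic_field_derivative:
  assumes sol: "scheme_solution \<gamma> r Nx Ny \<Delta>x \<Delta>y Fx Fy T U"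
    and "t \<in> T" "i \<in> {0..<int Nx}" "j \<in> {0..<int Ny}"
  defines "e \<equiv> vertex_Ez (\<lambda>k l. maxwell_part (U t k l))"
  obtains dB where
    "((\<lambda>s. magnetic (maxwell_part (U s i j))) has_vector_derivative dB) (at t within T)"
    "dB $ 1 = - curl_x \<Delta>y e i j" "dB $ 2 = - curl_y \<Delta>x e i j"
proof -
  let ?V = "\<lambda>k l. maxwell_part (U t k l)"
  obtain w dU where deriv: "((\<lambda>s. U s i j) has_vector_derivative dU) (at t within T)"
    and eq: "dU
        + (1/\<Delta>x) *\<^sub>R (full_flux Fx maxwell_flux_x (U t) i j
                    - full_flux Fx maxwell_flux_x (U t) (i-1) j)
        + (1/\<Delta>y) *\<^sub>R (full_flux Fy maxwell_flux_y (U t) i j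
                    - full_flux Fy maxwell_flux_y (U t) i (j-1))
        = source r w (maxwell_part (U t i j))"
    using sol[unfolded scheme_solution_def, rule_format, OF assms(2-4)] by blast
  let ?dB = "magnetic (maxwell_part dU)"
  have "bounded_linear (\<lambda>u :: state. magnetic (maxwell_part u))"
    by (intro bounded_linear_fst_comp bounded_linear_snd_comp bounded_linear_ident)
  from bounded_linear.has_vector_derivative[OF this deriv]
  have dB: "((\<lambda>s. magnetic (maxwell_part (U s i j))) has_vector_derivative ?dB) (at t within T)" .
  \<comment> \<open>The source has no magnetic part, so the magnetic fluxes balance.\<close>
  have balance: "?dB
      + (1/\<Delta>x) *\<^sub>R (magnetic (maxwell_flux_x ?V i j) - magnetic (maxwell_flux_x ?V (i-1) j))
      + (1/\<Delta>y) *\<^sub>R (magnetic (maxwell_flux_y ?V i j) - magnetic (maxwell_flux_y ?V i (j-1))) = 0"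
    using arg_cong[OF eq, of "\<lambda>u. magnetic (maxwell_part u)"]
    by (simp only: full_flux_def source_def fst_add snd_add fst_diff snd_diff fst_scaleR
        snd_scaleR fst_conv snd_conv)
  have "?dB $ 1 + 1/\<Delta>y * (1/2 * (e i j + e (i-1) j) - 1/2 * (e i (j-1) + e (i-1) (j-1))) = 0"
    using arg_cong[OF balance, of "\<lambda>v. v $ 1"]
    by (simp only: maxwell_flux_x_def maxwell_flux_y_def e_def fst_conv vector_3
        vector_add_component vector_minus_component vector_scaleR_component zero_index
        real_scaleR_def diff_self mult_zero_right add_0_right)
  moreover have "1/\<Delta>y * (1/2 * (e i j + e (i-1) j) - 1/2 * (e i (j-1) + e (i-1) (j-1)))
      = curl_x \<Delta>y e i j"
    by (cases "\<Delta>y = 0") (simp_all add: curl_x_def field_simps)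
  ultimately have Bx: "?dB $ 1 = - curl_x \<Delta>y e i j" by linarith
  have "?dB $ 2 + 1/\<Delta>x * (- (1/2) * (e i j + e i (j-1)) - - (1/2) * (e (i-1) j + e (i-1) (j-1))) = 0"
    using arg_cong[OF balance, of "\<lambda>v. v $ 2"]
    by (simp only: maxwell_flux_x_def maxwell_flux_y_def e_def fst_conv vector_3
        vector_add_component vector_minus_component vector_scaleR_component zero_index
        real_scaleR_def diff_self mult_zero_right add_0_right)
  moreover have "1/\<Delta>x * (- (1/2) * (e i j + e i (j-1)) - - (1/2) * (e (i-1) j + e (i-1) (j-1)))
      = curl_y \<Delta>x e i j"
    by (cases "\<Delta>x = 0") (simp_all add: curl_y_def field_simps)
  ultimately have By: "?dB $ 2 = - curl_y \<Delta>x e i j" by linarith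
  show thesis using that[OF dB Bx By] .
qed

theorem theorem3p2:
  fixes a b c d \<Delta>x \<Delta>y :: real
    and Nx Ny :: nat
    and \<gamma> r :: "species \<Rightarrow> real"
    and Fx Fy :: "species \<Rightarrow> numerical_flux"
    and T :: "real set"
    and U :: "real \<Rightarrow> state grid"
  assumes "a < b" and "c < d" and "Nx > 0" and "Ny > 0"
    and "\<Delta>x = (b - a) / real Nx" and "\<Delta>y = (d - c) / real Ny"
    and "\<And>\<alpha>. 1 < \<gamma> \<alpha> \<and> \<gamma> \<alpha> \<le> 2"
    and "\<And>\<alpha>. consistent_flux \<gamma> \<alpha> 1 (Fx \<alpha>)"
    and "\<And>\<alpha>. consistent_flux \<gamma> \<alpha> 2 (Fy \<alpha>)"
    and "is_interval T"
    and "scheme_solution \<gamma> r Nx Ny \<Delta>x \<Delta>y Fx Fy T U"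
  shows "\<forall>t\<in>T. \<forall>i\<in>{0..int Nx - 2}. \<forall>j\<in>{0..int Ny - 2}.
    ((\<lambda>s. discrete_div \<Delta>x \<Delta>y (\<lambda>k l. magnetic (maxwell_part (U s k l))) i j)
       has_real_derivative 0) (at t within T)"
proof (intro ballI)
  fix t i j assume t: "t \<in> T" and i: "i \<in> {0..int Nx - 2}" and j: "j \<in> {0..int Ny - 2}"
  let ?B = "\<lambda>s k l. magnetic (maxwell_part (U s k l))"
  let ?e = "vertex_Ez (\<lambda>k l. maxwell_part (U t k l))"
  \<comment> \<open>The upper bounds on \<open>i\<close> and \<open>j\<close> keep all four cells around the vertex inside the grid.\<close>
  have "\<forall>k l. \<exists>dB. k \<in> {i, i+1} \<longrightarrow> l \<in> {j, j+1} \<longrightarrow>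
      ((\<lambda>s. ?B s k l) has_vector_derivative dB) (at t within T) \<and>
      dB $ 1 = - curl_x \<Delta>y ?e k l \<and> dB $ 2 = - curl_y \<Delta>x ?e k l"
  proof (intro allI)
    fix k l
    show "\<exists>dB. k \<in> {i, i+1} \<longrightarrow> l \<in> {j, j+1} \<longrightarrow>
      ((\<lambda>s. ?B s k l) has_vector_derivative dB) (at t within T) \<and>
      dB $ 1 = - curl_x \<Delta>y ?e k l \<and> dB $ 2 = - curl_y \<Delta>x ?e k l"
    proof (cases "k \<in> {i, i+1} \<and> l \<in> {j, j+1}")
      case True
      with i j have "k \<in> {0..<int Nx}" "l \<in> {0..<int Ny}" by auto
      from magnetic_field_derivative[OF assms(11) t this] show ?thesis by blast
    qed blast
  qed
  then obtain dB where dB: "\<And>k l. k \<in> {i, i+1} \<Longrightarrow> l \<in> {j, j+1} \<Longrightarrow>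
      ((\<lambda>s. ?B s k l) has_vector_derivative dB k l) (at t within T) \<and>
      dB k l $ 1 = - curl_x \<Delta>y ?e k l \<and> dB k l $ 2 = - curl_y \<Delta>x ?e k l"
    by metis
  have "discrete_div \<Delta>x \<Delta>y dB i j = 0"
    using dB by (intro discrete_div_vertex_curl) blast+
  with discrete_div_has_real_derivative[of i j ?B dB t T \<Delta>x \<Delta>y] dB
  show "((\<lambda>s. discrete_div \<Delta>x \<Delta>y (?B s) i j) has_real_derivative 0) (at t within T)"
    by simp
qed

end
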